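(* Let $\mathcal{P}$ be a predicate on labeled trees. Then, for every $t\ge 1$, $$\mathsf{size\text{-}pls}(\mathcal{P},t)=O\left(\left\lceil \frac{\mathsf{size\text{-}pls}(\mathcal{P})}{t}\right\rceil\right),$$ where both quantities are functions of the number $n$ of nodes, are taken over the class of labeled $n$-node trees, and the constant hidden in the $O$ does not depend on $n$ or $t$.
   Context: Model. A labeled graph is a pair $(G,x)$ where $G=(V,E)$ is a finite connected simple graph and $x:V\to\{0,1\}^*$ assigns a bit-string (label) to every node. An identity assignment is an injective map $\mathrm{ID}:V\to[1,n^c]$ for some fixed $c\ge 1$, where $n=|V|$. A predicate $\mathcal{P}$ on a class of labeled graphs is a Boolean function of $(G,x)$ (possibly depending also on $\mathrm{ID}$). A proof-labeling scheme (PLS) for $\mathcal{P}$ is a pair $(\mathbf{p},\mathbf{v})$, where the prover $\mathbf{p}$ assigns to every node $v$ of every instance $(G,x,\mathrm{ID})$ a bit-string called certificate, and the verifier $\mathbf{v}$ is a deterministic distributed algorithm in the LOCAL model in which every node outputs accept or reject, such that: (i) if $(G,x,\mathrm{ID})$ satisfies $\mathcal{P}$, then all nodes accept with the certificates given by $\mathbf{p}$; (ii) if $(G,x,\mathrm{ID})$ does not satisfy $\mathcal{P}$, then for every assignment of certificates to the nodes, at least one node rejects. The radius of the scheme is the maximum number of rounds of $\mathbf{v}$; a $t$-PLS is a scheme of radius $t$: equivalently, each node $v$ decides from $t$, the structure of the ball of radius $t$ around $v$, and the identities, labels and certificates of the nodes at distance at most $t$ from $v$ (arbitrary local computation is allowed).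 The size of a scheme, as a function of $n$, is the maximum number of bits of a certificate assigned by $\mathbf{p}$ to a node, over all $n$-node instances satisfying $\mathcal{P}$. $\mathsf{size\text{-}pls}(\mathcal{P},t)$ is the minimum size of a PLS for $\mathcal{P}$ of radius at most $t$ on the considered class of $n$-node labeled graphs, and $\mathsf{size\text{-}pls}(\mathcal{P})=\mathsf{size\text{-}pls}(\mathcal{P},1)$. *)

theory Defs
  imports Complex_Main "HOL-Library.Extended_Nat" "Graph_Theory.Graph_Theory"
begin

section \<open>Labeled graphs and identity assignments\<close>

text \<open>
  A finite simple graph is a \<^locale>\<open>pair_graph\<close>: every undirected edge is represented by its two
  opposite arcs. A labeled graph is a pair \<open>(G, x)\<close>, where \<open>x\<close> assigns a bit string to every
  node; the values of \<open>x\<close> outside the vertex set are irrelevant.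
\<close>

type_synonym bits = "bool list"

type_synonym 'v lgraph = "'v pair_pre_digraph \<times> ('v \<Rightarrow> bits)"

type_synonym 'v predicate = "'v pair_pre_digraph \<Rightarrow> ('v \<Rightarrow> bits) \<Rightarrow> ('v \<Rightarrow> nat) \<Rightarrow> bool"

text \<open>
  The library's \<^const>\<open>tree\<close> is not suitable for symmetric digraphs: there the two arcs of a
  single edge already form a cycle (of length 2). Cycles of the undirected graph are exactly
  the library's cycles of length at least 3. The library's notion of connectedness includes that
  the vertex set is nonempty.
\<close>

definition is_tree :: "'v pair_pre_digraph \<Rightarrow> bool" where
  "is_tree G \<longleftrightarrow> pair_graph G \<and> Digraph_Component.connected (with_proj G) \<and>
     \<not> (\<exists>p. pre_digraph.cycle (with_proj G) p \<and> length p \<ge> 3)"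

definition labeled_trees :: "'v lgraph set" where
  "labeled_trees = {(G, x). is_tree G}"

definition id_assignment :: "real \<Rightarrow> 'v pair_pre_digraph \<Rightarrow> ('v \<Rightarrow> nat) \<Rightarrow> bool" where
  "id_assignment c G ident \<longleftrightarrow> inj_on ident (pverts G) \<and>
     (\<forall>v \<in> pverts G. 1 \<le> ident v \<and> real (ident v) \<le> real (card (pverts G)) powr c)"


section \<open>Local views and proof-labeling schemes\<close>

text \<open>The nodes at distance at most \<open>r\<close> from \<open>v\<close>.\<close>

definition graph_ball :: "'v pair_pre_digraph \<Rightarrow> 'v \<Rightarrow> nat \<Rightarrow> 'v set" where
  "graph_ball G v r = {u. \<exists>p. pre_digraph.awalk (with_proj G) v p u \<and> length p \<le> r}"

text \<open>
  What a node learns in \<open>r\<close> rounds. Nodes are named by their identities, so that a view does not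
  depend on the underlying vertex names: it consists of the identity of the observing node, the
  (identity, label, certificate) triples of the nodes of the ball, and the arcs of the subgraph
  induced by the ball.
\<close>

record local_view =
  view_center :: nat
  view_nodes :: "(nat \<times> bits \<times> bits) set"
  view_arcs :: "(nat \<times> nat) set"

definition local_view_at ::
  "nat \<Rightarrow> 'v pair_pre_digraph \<Rightarrow> ('v \<Rightarrow> bits) \<Rightarrow> ('v \<Rightarrow> nat) \<Rightarrow> ('v \<Rightarrow> bits) \<Rightarrow> 'v \<Rightarrow> local_view" where
  "local_view_at r G x ident cert v = (let B = graph_ball G v r in
     \<lparr> view_center = ident v,
       view_nodes = (\<lambda>u. (ident u, x u, cert u)) ` B,
       view_arcs = map_prod ident ident ` (parcs G \<inter> B \<times> B) \<rparr>)"

type_synonym 'v prover = "'v pair_pre_digraph \<Rightarrow> ('v \<Rightarrow> bits) \<Rightarrow> ('v \<Rightarrow> nat) \<Rightarrow> 'v \<Rightarrow> bits"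

type_synonym verifier = "local_view \<Rightarrow> bool"

definition is_pls ::
  "'v lgraph set \<Rightarrow> real \<Rightarrow> 'v predicate \<Rightarrow> nat \<Rightarrow> 'v prover \<Rightarrow> verifier \<Rightarrow> bool" where
  "is_pls \<C> c P r prover verifier \<longleftrightarrow>
     (\<forall>G x ident. (G, x) \<in> \<C> \<and> id_assignment c G ident \<longrightarrow>
        (P G x ident \<longrightarrow>
           (\<forall>v \<in> pverts G. verifier (local_view_at r G x ident (prover G x ident) v))) \<and>
        (\<not> P G x ident \<longrightarrow>
           (\<forall>cert. \<exists>v \<in> pverts G. \<not> verifier (local_view_at r G x ident cert v))))"


section \<open>Size\<close>

text \<open>
  The size lives in \<^typ>\<open>enat\<close> because labels are unbounded: already for a fixed number of nodes
  there may be no bound on the certificate length. The supremum over no instances is 0.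
\<close>

definition scheme_size ::
  "'v lgraph set \<Rightarrow> real \<Rightarrow> 'v predicate \<Rightarrow> 'v prover \<Rightarrow> nat \<Rightarrow> enat" where
  "scheme_size \<C> c P prover n =
     Sup {enat (length (prover G x ident v)) | G x ident v.
            (G, x) \<in> \<C> \<and> id_assignment c G ident \<and> card (pverts G) = n \<and>
            P G x ident \<and> v \<in> pverts G}"

text \<open>The infimum is \<open>\<infinity>\<close> if no scheme exists, and is attained otherwise.\<close>

definition size_pls :: "'v lgraph set \<Rightarrow> real \<Rightarrow> 'v predicate \<Rightarrow> nat \<Rightarrow> nat \<Rightarrow> enat" where
  "size_pls \<C> c P t n =
     Inf {scheme_size \<C> c P prover n | r prover verifier.
            r \<le> t \<and> is_pls \<C> c P r prover verifier}"

definition ceil_div :: "enat \<Rightarrow> nat \<Rightarrow> enat" where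
  "ceil_div s t = (case s of enat k \<Rightarrow> enat (nat \<lceil>real k / real t\<rceil>) | \<infinity> \<Rightarrow> \<infinity>)"

end

theory Submission
  imports Defs
begin

text \<open>
  Let \<open>k\<close> be proportional to \<open>t\<close>. Root the tree and cut it, at some of the nodes whose depth is a
  multiple of \<open>k\<close>, into domains of diameter \<open>O(k)\<close> such that every domain but the topmost one has
  at least \<open>k\<close> nodes. A domain has a single arc \<open>(p, b)\<close> to its parent domain. The two original
  certificates of \<open>p\<close> and \<open>b\<close> are written as one bit string, which is cut into chunks that are
  distributed over the nodes of the domain of \<open>b\<close> in the order of their identities, so that a node
  stores \<open>O(s / k)\<close> bits of it. Two further bits per node hold the number of cuts above the
  node modulo 3, which makes the domains and the direction of the cut arcs visible.

  A node sees its domain and all adjacent domains. It accepts if its domain is small and there are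
  original certificates for the domain that are accepted by the original verifier and that agree
  with the certificates stored for all cut arcs of the domain. Choosing such certificates for each
  domain independently yields certificates for the whole graph, because both sides of a cut
  arc are bound to the same stored pair. Soundness thus does not depend on the domains having
  been chosen in the intended way.
\<close>

section \<open>Rooted trees\<close>

text \<open>The arcs are tied exactly to the parent map, so that cutting, climbing and counting
  become arguments about iterates of \<open>par\<close> and no longer about walks and
  cycles.\<close>

locale rooted_tree =
  fixes V :: "'a set" and A :: "('a \<times> 'a) set" and r :: 'a
    and par :: "'a \<Rightarrow> 'a" and d :: "'a \<Rightarrow> nat"
  assumes finite_V: "finite V"
    and root_in: "r \<in> V"
    and depth_root: "d r = 0"
    and par_in: "v \<in> V \<Longrightarrow> v \<noteq> r \<Longrightarrow> par v \<in> V"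
    and depth_par: "v \<in> V \<Longrightarrow> v \<noteq> r \<Longrightarrow> d v = Suc (d (par v))"
    and arcs_eq: "A = (\<lambda>v. (v, par v)) ` (V - {r}) \<union> (\<lambda>v. (par v, v)) ` (V - {r})"

text \<open>A view names nodes by identities only. Renaming by an injective map lets the whole
  construction take place on the graph of identities.\<close>

lemma rooted_tree_image:
  assumes "rooted_tree V A r par d" "inj_on f V"
  shows "rooted_tree (f ` V) (map_prod f f ` A) (f r) (f \<circ> par \<circ> the_inv_into V f) (d \<circ> the_inv_into V f)"
proof -
  interpret rooted_tree V A r par d by fact
  have [simp]: "the_inv_into V f (f v) = v" if "v \<in> V" for v
    using assms(2) that by (simp add: the_inv_into_f_f)
  have [simp]: "f v = f w \<longleftrightarrow> v = w" if "v \<in> V" "w \<in> V" for v w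
    using assms(2) that by (auto dest: inj_onD)
  have diff: "f ` V - {f r} = f ` (V - {r})"
    using root_in by auto
  show ?thesis
  proof
    show "map_prod f f ` A =
      (\<lambda>v. (v, (f \<circ> par \<circ> the_inv_into V f) v)) ` (f ` V - {f r}) \<union>
      (\<lambda>v. ((f \<circ> par \<circ> the_inv_into V f) v, v)) ` (f ` V - {f r})"
      unfolding diff arcs_eq by (auto simp: image_image image_Un intro!: image_cong)
  qed (use root_in finite_V depth_root par_in depth_par in auto)
qed

section \<open>Walks, and the rooting of an acyclic connected graph\<close>

lemma awalk_of_rtrancl:
  assumes "R \<subseteq> parcs G" "pair_wf_digraph G" "(u, w) \<in> R\<^sup>*" "u \<in> pverts G"
  shows "\<exists>p. pre_digraph.awalk (with_proj G) u p w \<and> set p \<subseteq> R"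
proof -
  interpret pair_wf_digraph G by fact
  show ?thesis using assms(3,4)
  proof (induction rule: converse_rtrancl_induct)
    case base
    then show ?case by (intro exI[of _ "[]"]) (simp add: awalk_Nil_iff)
  next
    case (step u z)
    then have "(u, z) \<in> parcs G" using assms(1) by auto
    moreover from this have "z \<in> pverts G" by (rule in_arcsD2)
    ultimately obtain p where "awalk z p w" "set p \<subseteq> R" using step by auto
    then show ?case using step \<open>(u, z) \<in> parcs G\<close>
      by (intro exI[of _ "(u, z) # p"]) (auto simp: awalk_Cons_iff)
  qed
qed

lemma awalk_iff_relpow:
  assumes "pair_wf_digraph G" "u \<in> pverts G"
  shows "(\<exists>p. pre_digraph.awalk (with_proj G) u p w \<and> length p = m) \<longleftrightarrow> (u, w) \<in> parcs G ^^ m"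
proof -
  interpret pair_wf_digraph G by fact
  show ?thesis using assms(2)
  proof (induction m arbitrary: u)
    case 0
    then show ?case by (auto simp: awalk_Nil_iff)
  next
    case (Suc m)
    show ?case
    proof
      assume "\<exists>p. awalk u p w \<and> length p = Suc m"
      then obtain e p where p: "awalk u (e # p) w" "length p = m"
        by (metis length_Suc_conv)
      then have "e \<in> parcs G" "fst e = u" "awalk (snd e) p w" by (auto simp: awalk_Cons_iff)
      moreover from this have "(snd e, w) \<in> parcs G ^^ m"
        using Suc.IH[of "snd e"] p arc_snd_in_verts by blast
      ultimately show "(u, w) \<in> parcs G ^^ Suc m"
        by (metis prod.collapse relpow_Suc_I2)
    next
      assume "(u, w) \<in> parcs G ^^ Suc m"
      then obtain z where z: "(u, z) \<in> parcs G" "(z, w) \<in> parcs G ^^ m"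
        by (meson relpow_Suc_D2)
      then obtain p where "awalk z p w" "length p = m"
        using Suc.IH[of z] in_arcsD2 by blast
      then show "\<exists>p. awalk u p w \<and> length p = Suc m" using z Suc.prems
        by (intro exI[of _ "(u, z) # p"]) (auto simp: awalk_Cons_iff)
    qed
  qed
qed

text \<open>Two distinct neighbours of \<open>v\<close> joined by a walk that avoids
  \<open>v\<close> are also joined by such a path, and the two arcs at \<open>v\<close> close this
  path to a cycle of length at least 3.\<close>

lemma tree_neighbours_eq:
  assumes tree: "is_tree G" and arcs: "(u, v) \<in> parcs G" "(w, v) \<in> parcs G"
    and joined: "(u, w) \<in> (parcs G \<inter> {(a, b). a \<noteq> v \<and> b \<noteq> v})\<^sup>*"
  shows "u = w"
proof (rule ccontr)
  assume "u \<noteq> w"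
  interpret pair_graph G using tree by (simp add: is_tree_def)
  have uv: "u \<noteq> v" "w \<noteq> v" using arcs no_loops' by auto
  have vu: "(v, u) \<in> parcs G" using arcs arcs_symmetric by auto
  have uV: "u \<in> pverts G" "v \<in> pverts G" using arcs by (auto dest: in_arcsD1 in_arcsD2)
  obtain p where p: "awalk u p w" "set p \<subseteq> parcs G \<inter> {(a, b). a \<noteq> v \<and> b \<noteq> v}"
    using awalk_of_rtrancl[OF _ pair_wf_digraph joined uV(1)] by auto
  define q where "q = awalk_to_apath p"
  have q: "apath u q w" "set q \<subseteq> parcs G \<inter> {(a, b). a \<noteq> v \<and> b \<noteq> v}"
    using apath_awalk_to_apath[OF p(1)] awalk_to_apath_subset[OF p(1)] p(2) by (auto simp: q_def)
  then have qw: "awalk u q w" "distinct (awalk_verts u q)" by (auto simp: apath_def)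
  have "q \<noteq> []" using qw \<open>u \<noteq> w\<close> by (auto simp: awalk_Nil_iff)
  have vq: "v \<notin> set (awalk_verts u q)"
    using q(2) \<open>q \<noteq> []\<close> subsetD[OF q(2) last_in_set[OF \<open>q \<noteq> []\<close>]]
    by (auto simp: awalk_verts_conv split: prod.splits)
  have cw: "awalk v ((v, u) # q @ [(w, v)]) v"
    using qw(1) vu arcs uV by (auto simp: awalk_Cons_iff intro!: awalk_appendI simp: awalk_Nil_iff)
  moreover have "distinct (tl (awalk_verts v ((v, u) # q @ [(w, v)])))"
  proof -
    have "awalk_verts u q = map fst q @ [w]"
      using awalk_verts_conv[of u q] qw(1) \<open>q \<noteq> []\<close> by (auto elim!: awalkE)
    then show ?thesis using qw(2) vq by (auto simp: awalk_verts_conv)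
  qed
  ultimately have "cycle ((v, u) # q @ [(w, v)])" unfolding cycle_def by blast
  moreover have "length ((v, u) # q @ [(w, v)]) \<ge> 3" using \<open>q \<noteq> []\<close> by (cases q) auto
  ultimately show False using tree by (auto simp: is_tree_def)
qed

lemma tree_rooted:
  assumes tree: "is_tree G"
  obtains r par d where "rooted_tree (pverts G) (parcs G) r par d"
proof -
  interpret pair_graph G using tree by (simp add: is_tree_def)
  have con: "Digraph_Component.connected (with_proj G)" using tree by (simp add: is_tree_def)
  then obtain r where r: "r \<in> pverts G"
    by (auto simp: connected_def strongly_connected_def mk_symmetric_def)
  have reach: "(r, v) \<in> (parcs G)\<^sup>*" if "v \<in> pverts G" for v
  proof -
    have "r \<rightarrow>\<^sup>*\<^bsub>with_proj (mk_symmetric (with_proj G))\<^esub> v"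
      using con that r by (auto simp: connected_def strongly_connected_def mk_symmetric_def)
    then have "r \<rightarrow>\<^sup>*\<^bsub>with_proj G\<^esub> v" using reachable_mk_symmetric_eq by auto
    then obtain p where "awalk r p v" by (auto simp: reachable_awalk)
    then show ?thesis using awalk_iff_relpow[OF pair_wf_digraph r] relpow_imp_rtrancl by blast
  qed
  \<comment> \<open>Depth is the distance from an arbitrary root, and a parent is any neighbour one
    step closer. What remains is that every arc joins a node to its parent.\<close>
  define d where "d v = (LEAST m. (r, v) \<in> parcs G ^^ m)" for v
  have d: "(r, v) \<in> parcs G ^^ d v" if "v \<in> pverts G" for v
    unfolding d_def using reach[OF that] by (auto intro: LeastI_ex dest: rtrancl_imp_relpow)
  have d_le: "d v \<le> m" if "(r, v) \<in> parcs G ^^ m" for v m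
    unfolding d_def using that by (rule Least_le)
  have dr: "d r = 0" using d_le[of r 0] by simp
  have ex: "\<exists>u. (u, v) \<in> parcs G \<and> d v = Suc (d u)" if v: "v \<in> pverts G" "v \<noteq> r" for v
  proof -
    have "d v \<noteq> 0" using d[OF v(1)] v(2) by (metis relpow_0_E)
    then obtain m where m: "d v = Suc m" by (cases "d v") auto
    then obtain u where u: "(r, u) \<in> parcs G ^^ m" "(u, v) \<in> parcs G"
      using d[OF v(1)] by auto
    have "(r, v) \<in> parcs G ^^ Suc (d u)" using u d[of u] in_arcsD1 by auto
    then show ?thesis using u m d_le[of u m] d_le[of v "Suc (d u)"] by auto
  qed
  define par where "par v = (SOME u. (u, v) \<in> parcs G \<and> d v = Suc (d u))" for v
  have par: "(par v, v) \<in> parcs G" "d v = Suc (d (par v))" if "v \<in> pverts G" "v \<noteq> r" for v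
    using someI_ex[OF ex[OF that]] by (auto simp: par_def)
  \<comment> \<open>Depth strictly decreases along parents, so the climb from a node
    \<open>u\<close> other than \<open>v\<close> that is not deeper than \<open>v\<close> never
    meets \<open>v\<close>.\<close>
  have up: "(u, r) \<in> (parcs G \<inter> {(a, b). a \<noteq> v \<and> b \<noteq> v})\<^sup>*"
    if "u \<in> pverts G" "u \<noteq> v" "d u \<le> d v" "v \<noteq> r" for u v
    using that
  proof (induction "d u" arbitrary: u)
    case 0
    then show ?case using par(2)[of u] by (cases "u = r") auto
  next
    case (Suc m)
    then have "u \<noteq> r" using dr by auto
    note pu = par[OF Suc.prems(1) this]
    have "(par u, r) \<in> (parcs G \<inter> {(a, b). a \<noteq> v \<and> b \<noteq> v})\<^sup>*"
      using Suc pu by (intro Suc.hyps(1)) (auto dest: in_arcsD1)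
    moreover have "(u, par u) \<in> parcs G \<inter> {(a, b). a \<noteq> v \<and> b \<noteq> v}"
      using pu Suc arcs_symmetric by auto
    ultimately show ?case by (rule converse_rtrancl_into_rtrancl[rotated])
  qed
  have sym: "sym (parcs G \<inter> {(a, b). a \<noteq> v \<and> b \<noteq> v})" for v
    using arcs_symmetric by (auto simp: sym_def)
  \<comment> \<open>Both \<open>u\<close> and \<open>par v\<close> are neighbours of
    \<open>v\<close> that reach the root without passing through \<open>v\<close>, so they coincide.
    This excludes a second parent as well as arcs between nodes of equal depth.\<close>
  have lower: "v \<noteq> r \<and> u = par v" if uv: "(u, v) \<in> parcs G" "d u \<le> d v" for u v
  proof
    have V: "u \<in> pverts G" "v \<in> pverts G" using uv by (auto dest: in_arcsD1 in_arcsD2)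
    have "u \<noteq> v" using uv no_loops' by auto
    then show "v \<noteq> r" using uv dr par(2)[OF V(1)] by auto
    note pv = par[OF V(2) this]
    have "(par v, r) \<in> (parcs G \<inter> {(a, b). a \<noteq> v \<and> b \<noteq> v})\<^sup>*"
      using pv \<open>v \<noteq> r\<close> by (intro up) (auto dest: in_arcsD1)
    moreover have "(u, r) \<in> (parcs G \<inter> {(a, b). a \<noteq> v \<and> b \<noteq> v})\<^sup>*"
      using uv V \<open>u \<noteq> v\<close> \<open>v \<noteq> r\<close> by (intro up) auto
    ultimately have "(u, par v) \<in> (parcs G \<inter> {(a, b). a \<noteq> v \<and> b \<noteq> v})\<^sup>*"
      using sym_rtrancl[OF sym[of v]] by (meson rtrancl_trans symD)
    then show "u = par v" using tree_neighbours_eq[OF tree uv(1) pv(1)] by blast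
  qed
  have arcs: "parcs G = (\<lambda>v. (v, par v)) ` (pverts G - {r}) \<union> (\<lambda>v. (par v, v)) ` (pverts G - {r})"
  proof (intro equalityI subsetI)
    fix e assume e: "e \<in> parcs G"
    obtain u v where uv: "e = (u, v)" by (cases e)
    then have "(u, v) \<in> parcs G" "(v, u) \<in> parcs G" "u \<in> pverts G" "v \<in> pverts G"
      using e arcs_symmetric by (auto dest: in_arcsD1 in_arcsD2)
    then show "e \<in> (\<lambda>v. (v, par v)) ` (pverts G - {r}) \<union> (\<lambda>v. (par v, v)) ` (pverts G - {r})"
      using lower[of u v] lower[of v u] uv by (cases "d u \<le> d v") auto
  qed (use par arcs_symmetric in auto)
  have "rooted_tree (pverts G) (parcs G) r par d"
    using r dr par pair_finite_verts arcs by unfold_locales (auto dest: in_arcsD1)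
  then show ?thesis by (rule that)
qed

section \<open>Domains of a rooted tree\<close>

lemma mod_3_distinct: "Suc n mod 3 \<noteq> n mod 3" "Suc (Suc n) mod 3 \<noteq> n mod (3::nat)"
  by presburger+

lemma sym_relpow: "sym R \<Longrightarrow> (x, y) \<in> R ^^ n \<Longrightarrow> (y, x) \<in> R ^^ n"
proof (induction n arbitrary: y)
  case (Suc n)
  then obtain z where "(x, z) \<in> R ^^ n" "(z, y) \<in> R" by auto
  then show ?case using Suc by (meson relpow_Suc_I2 symD)
qed simp

context rooted_tree
begin

lemma par_pow:
  assumes "v \<in> V" "i \<le> d v"
  shows "(par ^^ i) v \<in> V \<and> d ((par ^^ i) v) = d v - i"
  using assms(2)
proof (induction i)
  case (Suc i)
  then have "d ((par ^^ i) v) = d v - i" "(par ^^ i) v \<in> V" by auto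
  moreover from this have "(par ^^ i) v \<noteq> r" using Suc depth_root by force
  ultimately show ?case using par_in[of "(par ^^ i) v"] depth_par[of "(par ^^ i) v"] by auto
qed (use assms in simp)

lemma depth_0: "v \<in> V \<Longrightarrow> d v = 0 \<longleftrightarrow> v = r"
  using depth_root depth_par by force

lemma par_pow_depth: "v \<in> V \<Longrightarrow> (par ^^ d v) v = r"
  using par_pow[of v "d v"] depth_0 by auto

text \<open>Cutting only above nodes with a descendant \<open>k - 1\<close> levels deeper leaves each domain \<open>k\<close> nodes.\<close>

definition border :: "nat \<Rightarrow> 'a \<Rightarrow> bool" where
  "border k v \<longleftrightarrow> v = r \<or> k dvd d v \<and> (\<exists>u \<in> V. d u = d v + (k - 1) \<and> (par ^^ (k - 1)) u = v)"

definition climb :: "nat \<Rightarrow> 'a \<Rightarrow> nat" where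
  "climb k v = (LEAST i. border k ((par ^^ i) v))"

text \<open>The topmost node of the domain of \<open>v\<close>; it serves as the name of the
  domain.\<close>

definition anchor :: "nat \<Rightarrow> 'a \<Rightarrow> 'a" where
  "anchor k v = (par ^^ climb k v) v"

text \<open>The number of cuts on the way from \<open>v\<close> to the root. The bound
  \<open>i < d v\<close> excludes the root, which is a border node without a cut above it.\<close>

definition rank :: "nat \<Rightarrow> 'a \<Rightarrow> nat" where
  "rank k v = card {i. i < d v \<and> border k ((par ^^ i) v)}"

lemma climb_le: "v \<in> V \<Longrightarrow> climb k v \<le> d v"
  unfolding climb_def by (rule Least_le) (simp add: par_pow_depth border_def)

lemma not_border_below: "i < climb k v \<Longrightarrow> \<not> border k ((par ^^ i) v)"
  unfolding climb_def by (rule not_less_Least)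

lemma climb_border: "border k v \<Longrightarrow> climb k v = 0"
  unfolding climb_def by (rule Least_eq_0) simp

lemma anchor_border: "border k v \<Longrightarrow> anchor k v = v"
  by (simp add: anchor_def climb_border)

lemma climb_not_border:
  assumes "v \<in> V" "\<not> border k v"
  shows "climb k v = Suc (climb k (par v))"
proof -
  have "border k ((par ^^ d v) v)" by (simp add: par_pow_depth assms border_def)
  then show ?thesis unfolding climb_def
    using Least_Suc[of "\<lambda>i. border k ((par ^^ i) v)" "d v"] assms(2)
    by (simp add: funpow_swap1)
qed

lemma anchor_par: "v \<in> V \<Longrightarrow> \<not> border k v \<Longrightarrow> anchor k (par v) = anchor k v"
  by (simp add: anchor_def climb_not_border funpow_swap1)

lemma rank_par:
  assumes "v \<in> V" "v \<noteq> r"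
  shows "rank k v = rank k (par v) + (if border k v then 1 else 0)"
proof -
  have "{i. i < d v \<and> border k ((par ^^ i) v)} =
    (if border k v then {0} else {}) \<union> Suc ` {i. i < d (par v) \<and> border k ((par ^^ i) (par v))}"
    (is "?L = ?B \<union> Suc ` ?R")
  proof -
    have "i \<in> ?L \<longleftrightarrow> i \<in> ?B \<union> Suc ` ?R" for i
      using depth_par[OF assms] by (cases i) (auto simp: funpow_swap1)
    then show ?thesis by blast
  qed
  then have "rank k v = card (?B \<union> Suc ` ?R)" by (simp add: rank_def)
  also have "\<dots> = card ?B + card (Suc ` ?R)" by (rule card_Un_disjoint) auto
  also have "card (Suc ` ?R) = rank k (par v)" by (simp add: card_image rank_def)
  finally show ?thesis by auto
qed

text \<open>Among the ancestors between \<open>k - 1\<close> and \<open>2 * k - 1\<close> levels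
  above \<open>v\<close> one has a depth divisible by \<open>k\<close>. The path from
  \<open>v\<close> itself supplies the descendant that makes it a border node.\<close>

lemma climb_less:
  assumes "v \<in> V" "k \<ge> 1"
  shows "climb k v < 2 * k"
proof (rule ccontr)
  assume "\<not> climb k v < 2 * k"
  then have c: "2 * k \<le> climb k v" by simp
  then have dv: "2 * k \<le> d v" using climb_le[OF assms(1), of k] by simp
  \<comment> \<open>The least number from \<open>k - 1\<close> on for which \<open>d v - i\<close>
    is a multiple of \<open>k\<close>.\<close>
  define i where "i = k - 1 + (d v - (k - 1)) mod k"
  have i: "k - 1 \<le> i" "i < 2 * k" using assms(2) mod_less_divisor[of k "d v - (k - 1)"] unfolding i_def
    by linarith+
  have "k dvd (d v - (k - 1)) - (d v - (k - 1)) mod k" by (rule dvd_minus_mod)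
  then have dvd: "k dvd d v - i" by (simp only: i_def diff_diff_left)
  let ?u = "(par ^^ (i - (k - 1))) v" and ?z = "(par ^^ i) v"
  have "?u \<in> V" "d ?u = d v - (i - (k - 1))" "d ?z = d v - i"
    using par_pow[OF assms(1), of "i - (k - 1)"] par_pow[OF assms(1), of i] i dv by auto
  moreover have "(par ^^ (k - 1)) ?u = ?z"
    using i by (metis comp_apply funpow_add le_add_diff_inverse)
  ultimately have "border k ?z" unfolding border_def using dvd i dv
    by (intro disjI2 conjI bexI[of _ ?u]) auto
  then show False using not_border_below[of i k v] c i by auto
qed

text \<open>The descendant \<open>u\<close> that makes \<open>b\<close> a border node yields a path
  of \<open>k\<close> nodes up to \<open>b\<close>. Below \<open>b\<close> their depths lie strictly
  between consecutive multiples of \<open>k\<close>, so none of them is a border node and all belong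
  to the domain of \<open>b\<close>.\<close>

lemma card_domain:
  assumes b: "b \<in> V" "border k b" "b \<noteq> r" and k: "k \<ge> 1"
  shows "k \<le> card {u \<in> V. anchor k u = b}"
proof -
  obtain u where u: "u \<in> V" "d u = d b + (k - 1)" "(par ^^ (k - 1)) u = b" and dvd: "k dvd d b"
    using b by (auto simp: border_def)
  have V: "(par ^^ i) u \<in> V \<and> d ((par ^^ i) u) = d b + (k - 1) - i" if "i < k" for i
    using par_pow[OF u(1), of i] u(2) that by auto
  \<comment> \<open>Induction down the path, from \<open>b\<close> at \<open>i = k - 1\<close> to
    \<open>u\<close> at \<open>i = 0\<close>.\<close>
  have anchor: "anchor k ((par ^^ i) u) = b" if "i < k" for i
    using that
  proof (induction "k - 1 - i" arbitrary: i)
    case 0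
    then have "i = k - 1" by simp
    then show ?case using u b anchor_border by simp
  next
    case (Suc m)
    let ?w = "(par ^^ i) u"
    have di: "d ?w = d b + (k - 1 - i)" "0 < k - 1 - i" "k - 1 - i < k" using V[of i] Suc by auto
    have "?w \<noteq> r" using di depth_root by auto
    moreover have "\<not> k dvd d ?w" using di dvd by (metis dvd_add_right_iff nat_dvd_not_less)
    ultimately have "\<not> border k ?w" by (auto simp: border_def)
    then have "anchor k ?w = anchor k (par ?w)" using V[of i] Suc anchor_par by simp
    also have "\<dots> = b" using Suc.hyps(1)[of "Suc i"] Suc by simp
    finally show ?case .
  qed
  have "inj_on (\<lambda>i. (par ^^ i) u) {..<k}"
  proof (rule inj_onI)
    fix i j assume ij: "i \<in> {..<k}" "j \<in> {..<k}" "(par ^^ i) u = (par ^^ j) u"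
    then have "d b + (k - 1) - i = d b + (k - 1) - j" using V[of i] V[of j] by auto
    then show "i = j" using ij by auto
  qed
  then have "k = card ((\<lambda>i. (par ^^ i) u) ` {..<k})" by (simp add: card_image)
  also have "\<dots> \<le> card {u \<in> V. anchor k u = b}"
    using V anchor finite_V by (intro card_mono) auto
  finally show ?thesis .
qed

section \<open>Recognising domains and cut arcs from levels modulo 3\<close>

definition level_arcs :: "nat \<Rightarrow> ('a \<times> 'a) set" where
  "level_arcs k = {(u, v) \<in> A. rank k u mod 3 = rank k v mod 3}"

lemma arcs_cases:
  assumes "(u, v) \<in> A"
  obtains "u \<in> V" "u \<noteq> r" "v = par u" | "v \<in> V" "v \<noteq> r" "u = par v"
  using assms unfolding arcs_eq by auto

lemma arcs_sym: "(u, v) \<in> A \<Longrightarrow> (v, u) \<in> A"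
  unfolding arcs_eq by auto

lemma par_arc: "v \<in> V \<Longrightarrow> v \<noteq> r \<Longrightarrow> (v, par v) \<in> A"
  unfolding arcs_eq by auto

text \<open>Ranks differ by at most 1 along an arc, so equal residues mean equal ranks, and then the
  lower end is not a border node.\<close>

lemma level_arcs_anchor:
  assumes "(u, v) \<in> level_arcs k"
  shows "anchor k u = anchor k v"
proof -
  have uv: "(u, v) \<in> A" "rank k u mod 3 = rank k v mod 3" using assms by (auto simp: level_arcs_def)
  from uv(1) show ?thesis
  proof (cases rule: arcs_cases)
    case 1
    then have "\<not> border k u" using uv(2) rank_par[of u k] mod_3_distinct by auto
    then show ?thesis using anchor_par 1 by simp
  next
    case 2
    then have "rank k v = rank k u + (if border k v then 1 else 0)" using rank_par by simp
    then have "\<not> border k v" using uv(2) mod_3_distinct(1)[of "rank k u"] by (auto split: if_splits)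
    then show ?thesis using anchor_par 2 by simp
  qed
qed

lemma sym_level_arcs: "sym (level_arcs k)"
  by (auto simp: sym_def level_arcs_def intro: arcs_sym)

lemma level_arcs_climb:
  assumes "v \<in> V"
  shows "(v, anchor k v) \<in> level_arcs k ^^ climb k v"
  using assms
proof (induction "climb k v" arbitrary: v)
  case 0
  then show ?case by (simp add: anchor_def flip: 0(1))
next
  case (Suc m)
  then have nb: "\<not> border k v" using climb_border by fastforce
  then have vr: "v \<noteq> r" by (auto simp: border_def)
  have m: "climb k (par v) = m" using climb_not_border[OF Suc.prems nb] Suc.hyps(2) by simp
  have "(v, par v) \<in> level_arcs k"
    using rank_par[OF Suc.prems vr, of k] par_arc[OF Suc.prems vr] nb by (auto simp: level_arcs_def)
  moreover have "(par v, anchor k (par v)) \<in> level_arcs k ^^ m"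
    using Suc.hyps(1)[of "par v"] m par_in[OF Suc.prems vr] by simp
  ultimately show ?case using anchor_par[OF Suc.prems nb] Suc.hyps(2)
    by (metis relpow_Suc_I2)
qed

text \<open>The walk climbs from \<open>u\<close> to the common anchor and descends to
  \<open>v\<close>; each half has length less than \<open>2 * k\<close>.\<close>

lemma level_arcs_connect:
  assumes "u \<in> V" "v \<in> V" "anchor k u = anchor k v" "k \<ge> 1"
  shows "\<exists>m \<le> 4 * k. (u, v) \<in> level_arcs k ^^ m"
proof -
  have "(anchor k v, v) \<in> level_arcs k ^^ climb k v"
    using sym_relpow[OF sym_level_arcs level_arcs_climb[OF assms(2)]] .
  then have "(u, v) \<in> level_arcs k ^^ (climb k u + climb k v)"
    using level_arcs_climb[OF assms(1), of k] assms(3) by (auto simp: relpow_add)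
  then show ?thesis using climb_less[of u k] climb_less[of v k] assms
    by (intro exI[of _ "climb k u + climb k v"]) auto
qed

text \<open>The domains are the connected components of the arcs whose ends agree in level, and
  these a verifier can see.\<close>

lemma level_arcs_rtrancl:
  assumes "u \<in> V" "k \<ge> 1"
  shows "(u, v) \<in> (level_arcs k)\<^sup>* \<longleftrightarrow> v \<in> V \<and> anchor k u = anchor k v"
proof
  assume "(u, v) \<in> (level_arcs k)\<^sup>*"
  then show "v \<in> V \<and> anchor k u = anchor k v"
  proof (induction rule: rtrancl_induct)
    case (step y z)
    then have "(y, z) \<in> A" by (auto simp: level_arcs_def)
    then have "z \<in> V" using par_in unfolding arcs_eq by auto
    then show ?case using step level_arcs_anchor by auto
  qed (use assms in simp)
qed (use level_arcs_connect[of u v k] assms in \<open>auto intro: relpow_imp_rtrancl\<close>)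

text \<open>If \<open>p\<close> were the child, the rank of \<open>b\<close> minus that of
  \<open>p\<close> would be 0 or -1, and neither is congruent to 1 modulo 3. Three levels thus
  suffice to orient the cut arcs.\<close>

lemma up_arc:
  assumes "(p, b) \<in> A" "rank k b mod 3 = Suc (rank k p) mod 3"
  shows "b \<in> V \<and> b \<noteq> r \<and> p = par b \<and> border k b"
  using assms(1)
proof (cases rule: arcs_cases)
  case 1
  then have "rank k p = rank k b + (if border k p then 1 else 0)" using rank_par by simp
  then have False using assms(2) mod_3_distinct[of "rank k b"] by (auto split: if_splits)
  then show ?thesis ..
next
  case 2
  then have "rank k b = rank k p + (if border k b then 1 else 0)" using rank_par by simp
  then have "border k b" using assms(2) mod_3_distinct(1)[of "rank k p"] by (auto split: if_splits)
  then show ?thesis using 2 by simp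
qed

end

section \<open>Views on the graph of identities\<close>

text \<open>Even under arbitrary certificates, exactly one end of an arc between different levels
  counts as the upper one.\<close>

lemma mod_3_cases:
  fixes a b :: nat
  assumes "a < 3" "b < 3" "a \<noteq> b"
  shows "b = Suc a mod 3 \<longleftrightarrow> a \<noteq> Suc b mod 3"
proof -
  have "a \<in> {0, 1, 2}" "b \<in> {0, 1, 2}" using assms by auto
  then show ?thesis using assms(3) by (elim insertE emptyE; simp)
qed

text \<open>The ball of radius \<open>n\<close> around \<open>i\<close> in the graph of
  identities.\<close>

definition nbh :: "('a \<times> 'a) set \<Rightarrow> 'a \<Rightarrow> nat \<Rightarrow> 'a set" where
  "nbh A i n = {j. \<exists>m \<le> n. (i, j) \<in> A ^^ m}"

lemma nbh_relpow: "(i, j) \<in> A ^^ m \<Longrightarrow> m \<le> n \<Longrightarrow> j \<in> nbh A i n"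
  unfolding nbh_def by blast

lemma nbh_self [simp]: "i \<in> nbh A i n"
  by (rule nbh_relpow[where m = 0]) simp_all

lemma nbh_trans:
  assumes "j \<in> nbh A i m" "l \<in> nbh A j n" "m + n \<le> t"
  shows "l \<in> nbh A i t"
proof -
  obtain a b where "a \<le> m" "(i, j) \<in> A ^^ a" "b \<le> n" "(j, l) \<in> A ^^ b"
    using assms by (auto simp: nbh_def)
  then have "(i, l) \<in> A ^^ (a + b)" "a + b \<le> t" using assms(3) by (auto simp: relpow_add)
  then show ?thesis by (auto simp: nbh_def)
qed

lemma nbh_mono: "m \<le> n \<Longrightarrow> nbh A i m \<subseteq> nbh A i n"
  unfolding nbh_def using order_trans[of _ m n] by blast

lemma relpow_mono: "A \<subseteq> A' \<Longrightarrow> A ^^ m \<subseteq> A' ^^ m" for A :: "('a \<times> 'a) set"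
  by (induction m) (simp_all add: relcomp_mono)

lemma nbh_mono_rel: "A \<subseteq> A' \<Longrightarrow> nbh A i m \<subseteq> nbh A' i m"
  using relpow_mono[of A A'] unfolding nbh_def by blast

lemma nbh_arc: "(j, l) \<in> A \<Longrightarrow> l \<in> nbh A j 1"
  by (rule nbh_relpow[where m = 1]) simp_all

lemma nbh_le_1: "l \<in> nbh A j r \<Longrightarrow> r \<le> 1 \<Longrightarrow> l = j \<or> (j, l) \<in> A"
proof -
  assume "l \<in> nbh A j r" "r \<le> 1"
  then obtain m where "(j, l) \<in> A ^^ m" "m = 0 \<or> m = 1"
    unfolding nbh_def by fastforce
  then show ?thesis by (elim disjE) simp_all
qed

definition view_of ::
  "nat \<Rightarrow> (nat \<times> nat) set \<Rightarrow> (nat \<Rightarrow> bits) \<Rightarrow> (nat \<Rightarrow> bits) \<Rightarrow> nat \<Rightarrow> local_view" where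
  "view_of r A lab f i = \<lparr>view_center = i, view_nodes = (\<lambda>j. (j, lab j, f j)) ` nbh A i r,
     view_arcs = A \<inter> nbh A i r \<times> nbh A i r\<rparr>"

lemma relpow_image:
  assumes "R \<subseteq> V \<times> V" "inj_on f V" "v \<in> V"
  shows "(f v, y) \<in> (map_prod f f ` R) ^^ m \<longleftrightarrow> (\<exists>u \<in> V. y = f u \<and> (v, u) \<in> R ^^ m)"
proof (induction m arbitrary: y)
  case 0
  then show ?case using assms by auto
next
  case (Suc m)
  show ?case
  proof
    assume "(f v, y) \<in> (map_prod f f ` R) ^^ Suc m"
    then obtain z where z: "(f v, z) \<in> (map_prod f f ` R) ^^ m" "(z, y) \<in> map_prod f f ` R" by auto
    obtain u where u: "u \<in> V" "z = f u" "(v, u) \<in> R ^^ m" using Suc z(1) by auto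
    obtain a b where ab: "z = f a" "y = f b" "(a, b) \<in> R" using z(2) by auto
    then have "a = u" using u assms by (auto dest: inj_onD)
    then show "\<exists>u \<in> V. y = f u \<and> (v, u) \<in> R ^^ Suc m" using ab u assms(1) by auto
  next
    assume "\<exists>u \<in> V. y = f u \<and> (v, u) \<in> R ^^ Suc m"
    then obtain u w where "y = f u" "(v, w) \<in> R ^^ m" "(w, u) \<in> R" by auto
    moreover from this have "w \<in> V" using assms(1) by auto
    ultimately show "(f v, y) \<in> (map_prod f f ` R) ^^ Suc m"
      using Suc by (auto intro!: relcompI[of _ "f w"])
  qed
qed

text \<open>Injectivity of the identities makes the renaming commute with walks, balls and induced
  arcs.\<close>

lemma local_view_at_eq:
  assumes "pair_wf_digraph G" "inj_on ident (pverts G)" "v \<in> pverts G"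
    "\<And>u. u \<in> pverts G \<Longrightarrow> lab (ident u) = x u" "\<And>u. u \<in> pverts G \<Longrightarrow> f (ident u) = cert u"
  shows "local_view_at r G x ident cert v = view_of r (map_prod ident ident ` parcs G) lab f (ident v)"
proof -
  interpret pair_wf_digraph G by fact
  have sub: "parcs G \<subseteq> pverts G \<times> pverts G" by (auto dest: in_arcsD1 in_arcsD2)
  have ball: "graph_ball G v r = {u \<in> pverts G. \<exists>m \<le> r. (v, u) \<in> parcs G ^^ m}"
    unfolding graph_ball_def awalk_iff_relpow[OF assms(1,3), symmetric]
    by (auto intro: awalk_last_in_verts)
  have nbh: "nbh (map_prod ident ident ` parcs G) (ident v) r = ident ` graph_ball G v r"
    unfolding ball nbh_def relpow_image[OF sub assms(2,3)] by auto
  let ?B = "graph_ball G v r"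
  have "inj_on (map_prod ident ident) (pverts G \<times> pverts G)"
    by (rule map_prod_inj_on[OF assms(2) assms(2)])
  moreover have "?B \<times> ?B \<subseteq> pverts G \<times> pverts G" unfolding ball by blast
  ultimately have "map_prod ident ident ` (parcs G \<inter> ?B \<times> ?B) =
    map_prod ident ident ` parcs G \<inter> map_prod ident ident ` (?B \<times> ?B)"
    using sub by (intro inj_on_image_Int)
  also have "map_prod ident ident ` (?B \<times> ?B) = ident ` ?B \<times> ident ` ?B"
    by (rule map_prod_surj_on) simp_all
  finally have arcs: "map_prod ident ident ` (parcs G \<inter> ?B \<times> ?B) =
    map_prod ident ident ` parcs G \<inter> ident ` ?B \<times> ident ` ?B" .
  have nodes: "(\<lambda>u. (ident u, x u, cert u)) ` graph_ball G v r =
    (\<lambda>i. (i, lab i, f i)) ` ident ` graph_ball G v r"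
    unfolding image_image using assms(4,5) ball by (intro image_cong) simp_all
  show ?thesis unfolding local_view_at_def view_of_def Let_def nbh arcs nodes ..
qed

section \<open>The verifier for domains\<close>

text \<open>Certificates start with two bits that hold the level of the domain modulo 3.\<close>

definition level_code :: "nat \<Rightarrow> bits" where
  "level_code n = [n mod 3 = 1, n mod 3 = 2]"

text \<open>On strings that are too short the value is unspecified, but still less than 3, which is
  what soundness relies on.\<close>

definition level :: "bits \<Rightarrow> nat" where
  "level c = (if hd c then 1 else if hd (tl c) then 2 else 0)"

lemma level_level_code [simp]: "level (level_code n @ w) = n mod 3"
  by (simp add: level_def level_code_def) linarith

lemma level_less: "level c < 3"
  by (simp add: level_def)

section \<open>Packing a pair of bit strings and cutting it into chunks\<close>

definition join :: "bits \<Rightarrow> bits \<Rightarrow> bits" where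
  "join a b = replicate (length a) True @ False # a @ b"

definition unjoin :: "bits \<Rightarrow> bits \<times> bits" where
  "unjoin w = (let n = length (takeWhile id w) in (take n (drop (Suc n) w), drop (2 * n + 1) w))"

lemma unjoin_join [simp]: "unjoin (join a b) = (a, b)"
proof -
  have "takeWhile id (join a b) = replicate (length a) True"
    by (simp add: join_def takeWhile_append)
  then show ?thesis by (simp add: unjoin_def join_def)
qed

text \<open>The first string is preceded by its length in unary to make the pair decodable. Two
  certificates of at most \<open>s\<close> bits therefore cost at most \<open>3 * s + 1\<close>
  bits.\<close>

lemma length_join: "length (join a b) = 2 * length a + length b + 1"
  by (simp add: join_def)

text \<open>Greedy: each entry takes the next \<open>m\<close> bits, and later ones may get nothing.
  Distinctness allows the chunks to be a function of the entry.\<close>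

lemma split_into_chunks:
  assumes "distinct xs" "length w \<le> m * length xs"
  shows "\<exists>h. concat (map h xs) = w \<and> (\<forall>x. length (h x) \<le> m)"
  using assms
proof (induction xs arbitrary: w)
  case Nil
  then show ?case by (auto intro: exI[of _ "\<lambda>_. []"])
next
  case (Cons x xs)
  then have "length (drop m w) \<le> m * length xs" by auto
  then obtain h where h: "concat (map h xs) = drop m w" "\<forall>x. length (h x) \<le> m"
    using Cons by (meson distinct.simps(2))
  have "map (h(x := take m w)) xs = map h xs" using Cons.prems(1) by auto
  then have "concat (map (h(x := take m w)) (x # xs)) = w"
    using h(1) by (simp only: list.map concat.simps fun_upd_same append_take_drop_id)
  moreover have "\<forall>y. length ((h(x := take m w)) y) \<le> m" using h(2) by simp
  ultimately show ?case by blast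
qed

section \<open>Domains as read off from arbitrary certificates\<close>

definition level_rel :: "(nat \<times> nat) set \<Rightarrow> (nat \<Rightarrow> bits) \<Rightarrow> (nat \<times> nat) set" where
  "level_rel A c = {(i, j) \<in> A. level (c i) = level (c j)}"

definition dom_of :: "(nat \<times> nat) set \<Rightarrow> (nat \<Rightarrow> bits) \<Rightarrow> nat \<Rightarrow> nat set" where
  "dom_of A c i = (level_rel A c)\<^sup>* `` {i}"

text \<open>In the intended certificates the first component belongs to the parent end of the arc
  above the domain and the second to its end inside the domain.\<close>

definition payload :: "(nat \<times> nat) set \<Rightarrow> (nat \<Rightarrow> bits) \<Rightarrow> nat \<Rightarrow> bits \<times> bits" where
  "payload A c i = unjoin (concat (map (\<lambda>j. drop 2 (c j)) (sorted_list_of_set (dom_of A c i))))"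

text \<open>The pair for a cut arc is stored in the domain of its lower end, whose level is the
  successor modulo 3. Arbitrary certificates may give a domain several upward arcs; its single pair
  must then match each of them.\<close>

definition fits :: "verifier \<Rightarrow> nat \<Rightarrow> (nat \<times> nat) set \<Rightarrow> (nat \<Rightarrow> bits) \<Rightarrow> (nat \<Rightarrow> bits) \<Rightarrow>
    (nat \<Rightarrow> bits) \<Rightarrow> nat \<Rightarrow> bool" where
  "fits W r A lab c f i \<longleftrightarrow> W (view_of r A lab f i) \<and>
     (\<forall>j. (i, j) \<in> A \<longrightarrow> level (c j) \<noteq> level (c i) \<longrightarrow>
       (if level (c j) = Suc (level (c i)) mod 3 then payload A c j = (f i, f j)
        else payload A c i = (f j, f i)))"

text \<open>One \<open>f\<close> serves the whole domain. It is also evaluated across the cut arcs,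
  where the stored pairs prescribe its values.\<close>

definition good :: "nat \<Rightarrow> verifier \<Rightarrow> nat \<Rightarrow> (nat \<times> nat) set \<Rightarrow> (nat \<Rightarrow> bits) \<Rightarrow>
    (nat \<Rightarrow> bits) \<Rightarrow> nat \<Rightarrow> bool" where
  "good K W r A lab c i \<longleftrightarrow> dom_of A c i \<subseteq> nbh A i K \<and> (\<exists>f. \<forall>j \<in> dom_of A c i. fits W r A lab c f j)"

definition domain_verifier :: "nat \<Rightarrow> verifier \<Rightarrow> nat \<Rightarrow> verifier" where
  "domain_verifier K W r w = good K W r (view_arcs w)
     (\<lambda>i. fst (THE y. (i, y) \<in> view_nodes w)) (\<lambda>i. snd (THE y. (i, y) \<in> view_nodes w)) (view_center w)"

lemma dom_of_self [simp]: "i \<in> dom_of A c i"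
  by (simp add: dom_of_def)

lemma dom_of_eq:
  assumes "sym A" "j \<in> dom_of A c i"
  shows "dom_of A c j = dom_of A c i"
proof -
  have "sym (level_rel A c)" using assms(1) by (auto simp: sym_def level_rel_def)
  then have "sym ((level_rel A c)\<^sup>*)" by (rule sym_rtrancl)
  then show ?thesis using assms(2) by (auto simp: dom_of_def dest: symD intro: rtrancl_trans)
qed

section \<open>Passing from the local view to the whole graph\<close>

text \<open>The primed data are what node \<open>i\<close> reconstructs from its view; they agree
  with the true data only inside the ball.\<close>

locale view_restriction =
  fixes A A' :: "(nat \<times> nat) set" and i t :: nat and lab lab' c c' :: "nat \<Rightarrow> bits"
  assumes A'_eq: "A' = A \<inter> nbh A i t \<times> nbh A i t"
    and lab': "j \<in> nbh A i t \<Longrightarrow> lab' j = lab j"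
    and c': "j \<in> nbh A i t \<Longrightarrow> c' j = c j"
begin

lemma relpow_restrict:
  assumes "j \<in> nbh A i m" "(j, l) \<in> A ^^ n" "m + n \<le> t"
  shows "(j, l) \<in> A' ^^ n"
  using assms(2,3)
proof (induction n arbitrary: l)
  case (Suc n)
  then obtain y where y: "(j, y) \<in> A ^^ n" "(y, l) \<in> A" by auto
  have "y \<in> nbh A j n" "l \<in> nbh A j (Suc n)"
    using nbh_relpow[OF y(1)] nbh_relpow[OF Suc.prems(1)] by auto
  then have "y \<in> nbh A i t" "l \<in> nbh A i t"
    using nbh_trans[OF assms(1), of _ _ t] Suc.prems by auto
  then have "(y, l) \<in> A'" using y by (simp add: A'_eq)
  then show ?case using Suc y by auto
qed simp

lemma nbh_restrict:
  assumes "j \<in> nbh A i m" "m + n \<le> t"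
  shows "nbh A' j n = nbh A j n"
proof
  show "nbh A' j n \<subseteq> nbh A j n" by (rule nbh_mono_rel) (auto simp: A'_eq)
  show "nbh A j n \<subseteq> nbh A' j n"
    using relpow_restrict[OF assms(1)] assms(2) by (fastforce simp: nbh_def)
qed

lemma level_rel_restrict: "level_rel A' c' \<subseteq> level_rel A c"
  by (auto simp: level_rel_def A'_eq c')

lemma dom_of_restrict:
  assumes "dom_of A c j \<subseteq> nbh A i t"
  shows "dom_of A' c' j = dom_of A c j"
proof
  show "dom_of A' c' j \<subseteq> dom_of A c j"
    unfolding dom_of_def using rtrancl_mono[OF level_rel_restrict] by auto
  show "dom_of A c j \<subseteq> dom_of A' c' j"
  proof
    fix l assume "l \<in> dom_of A c j"
    then have "(j, l) \<in> (level_rel A c)\<^sup>*" by (simp add: dom_of_def)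
    then have "(j, l) \<in> (level_rel A' c')\<^sup>*"
    proof (induction rule: rtrancl_induct)
      case (step y z)
      then have "y \<in> dom_of A c j" "z \<in> dom_of A c j" by (auto simp: dom_of_def)
      then have "y \<in> nbh A i t" "z \<in> nbh A i t" using assms by auto
      then have "(y, z) \<in> level_rel A' c'" using step by (auto simp: level_rel_def A'_eq c')
      then show ?case using step by auto
    qed simp
    then show "l \<in> dom_of A' c' j" by (simp add: dom_of_def)
  qed
qed

text \<open>A verifier can test smallness only in the truncated graph. As \<open>K < t\<close>,
  every arc leaving a node at distance at most \<open>K\<close> is visible, so the true domain does
  not extend beyond the visible one.\<close>

lemma dom_of_restrict_bounded:
  assumes "dom_of A' c' i \<subseteq> nbh A' i K" "K < t"
  shows "dom_of A c i \<subseteq> nbh A i K"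
proof -
  have sub: "dom_of A' c' i \<subseteq> nbh A i K"
    using assms nbh_mono_rel[of A' A i K] by (auto simp: A'_eq)
  have "(i, l) \<in> (level_rel A' c')\<^sup>*" if "(i, l) \<in> (level_rel A c)\<^sup>*" for l
    using that
  proof (induction rule: rtrancl_induct)
    case (step y z)
    then have "y \<in> nbh A i K" using sub by (auto simp: dom_of_def)
    moreover have yz: "(y, z) \<in> A" "level (c y) = level (c z)" using step by (auto simp: level_rel_def)
    ultimately have "y \<in> nbh A i t" "z \<in> nbh A i t"
      using assms(2) nbh_trans[of y A i K z 1 t] nbh_arc[of y z A] nbh_mono[of K t A i] by auto
    then have "(y, z) \<in> level_rel A' c'" using yz by (auto simp: level_rel_def A'_eq c')
    then show ?case using step by auto
  qed simp
  then show ?thesis using sub by (auto simp: dom_of_def)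
qed

lemma view_of_restrict:
  assumes "j \<in> nbh A i m" "m + r \<le> t"
  shows "view_of r A' lab' f j = view_of r A lab f j"
proof -
  have "nbh A j r \<subseteq> nbh A i t" using nbh_trans[OF assms(1)] assms(2) by auto
  then have "(\<lambda>l. (l, lab' l, f l)) ` nbh A j r = (\<lambda>l. (l, lab l, f l)) ` nbh A j r"
    "A' \<inter> nbh A j r \<times> nbh A j r = A \<inter> nbh A j r \<times> nbh A j r"
    using lab' by (auto simp: A'_eq intro!: image_cong)
  then show ?thesis unfolding view_of_def nbh_restrict[OF assms] by simp
qed

lemma fits_restrict:
  assumes j: "j \<in> nbh A i K" and t: "2 * K + 2 \<le> t" and r: "r \<le> 1"
    and small: "\<And>l. l \<in> nbh A i t \<Longrightarrow> dom_of A c l \<subseteq> nbh A l K"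
  shows "fits W r A' lab' c' f j \<longleftrightarrow> fits W r A lab c f j"
proof -
  have view: "view_of r A' lab' f j = view_of r A lab f j"
    using view_of_restrict[OF j] t r by simp
  \<comment> \<open>A neighbour of the domain of \<open>i\<close> is at distance at most
    \<open>K + 1\<close>, and its own domain reaches at most \<open>K\<close> further. The stored
    pair is thus read within distance \<open>2 * K + 1\<close>, inside the ball.\<close>
  have pay: "payload A' c' l = payload A c l" if "l \<in> nbh A i (K + 1)" for l
  proof -
    have "l \<in> nbh A i t" using that nbh_mono[of "K + 1" t A i] t by auto
    then have "dom_of A c l \<subseteq> nbh A i t"
      using small[of l] nbh_trans[OF that] t by fastforce
    moreover from this have "dom_of A' c' l = dom_of A c l" by (rule dom_of_restrict)
    moreover have "map (\<lambda>j. drop 2 (c' j)) (sorted_list_of_set (dom_of A c l)) =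
      map (\<lambda>j. drop 2 (c j)) (sorted_list_of_set (dom_of A c l))"
    proof (cases "finite (dom_of A c l)")
      case True
      then show ?thesis using \<open>dom_of A c l \<subseteq> nbh A i t\<close> c' by (auto simp: subset_iff)
    qed simp
    ultimately show ?thesis by (simp only: payload_def)
  qed
  have jt: "j \<in> nbh A i t" "j \<in> nbh A i (K + 1)"
    using j t nbh_mono[of K t A i] nbh_mono[of K "K + 1" A i] by auto
  have arc: "l \<in> nbh A i t \<and> l \<in> nbh A i (K + 1)" if "(j, l) \<in> A" for l
    using nbh_trans[OF j nbh_arc[OF that], of t] nbh_trans[OF j nbh_arc[OF that], of "K + 1"] t
    by auto
  have mem: "(j, l) \<in> A' \<longleftrightarrow> (j, l) \<in> A" for l
    using arc[of l] jt by (auto simp: A'_eq)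
  have "payload A' c' l = payload A c l \<and> c' l = c l" if "(j, l) \<in> A" for l
    using arc[OF that] pay c' by simp
  moreover have "payload A' c' j = payload A c j \<and> c' j = c j"
    using jt pay c' by simp
  ultimately show ?thesis unfolding fits_def view mem by (metis (no_types))
qed

lemma good_restrict:
  assumes t: "2 * K + 2 \<le> t" and r: "r \<le> 1"
    and small: "\<And>l. l \<in> nbh A i t \<Longrightarrow> dom_of A c l \<subseteq> nbh A l K"
  shows "good K W r A' lab' c' i \<longleftrightarrow> good K W r A lab c i"
proof -
  have iK: "dom_of A c i \<subseteq> nbh A i K" using small[of i] by simp
  then have "dom_of A c i \<subseteq> nbh A i t" using nbh_mono[of K t A i] t by auto
  then have "dom_of A' c' i = dom_of A c i" by (rule dom_of_restrict)
  moreover have "nbh A' i K = nbh A i K" using nbh_restrict[of i 0 K] t by simp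
  ultimately show ?thesis unfolding good_def
    using fits_restrict[OF _ t r small] iK by (metis subsetD)
qed

end

section \<open>Evaluating the verifier on its own view\<close>

lemma domain_verifier_view:
  obtains lab' c' where
    "view_restriction A (A \<inter> nbh A i t \<times> nbh A i t) i t lab lab' c c'"
    "domain_verifier K W r (view_of t A lab c i) = good K W r (A \<inter> nbh A i t \<times> nbh A i t) lab' c' i"
proof -
  let ?N = "view_nodes (view_of t A lab c i)"
  have "(THE y. (j, y) \<in> ?N) = (lab j, c j)" if "j \<in> nbh A i t" for j
    using that by (intro the_equality) (auto simp: view_of_def)
  then have "view_restriction A (A \<inter> nbh A i t \<times> nbh A i t) i t
      lab (\<lambda>j. fst (THE y. (j, y) \<in> ?N)) c (\<lambda>j. snd (THE y. (j, y) \<in> ?N))"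
    by unfold_locales auto
  then show ?thesis by (rule that) (simp add: domain_verifier_def view_of_def)
qed

lemma domain_verifier_bounded:
  assumes "domain_verifier K W r (view_of t A lab c i)" "K < t"
  shows "dom_of A c i \<subseteq> nbh A i K"
proof -
  obtain lab' c' where
    v: "view_restriction A (A \<inter> nbh A i t \<times> nbh A i t) i t lab lab' c c'" and
    g: "domain_verifier K W r (view_of t A lab c i) = good K W r (A \<inter> nbh A i t \<times> nbh A i t) lab' c' i"
    by (rule domain_verifier_view)
  show ?thesis using view_restriction.dom_of_restrict_bounded[OF v] assms g by (simp add: good_def)
qed

lemma domain_verifier_iff_good:
  assumes "2 * K + 2 \<le> t" "r \<le> 1"
    and "\<And>l. l \<in> nbh A i t \<Longrightarrow> dom_of A c l \<subseteq> nbh A l K"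
  shows "domain_verifier K W r (view_of t A lab c i) \<longleftrightarrow> good K W r A lab c i"
proof -
  obtain lab' c' where
    v: "view_restriction A (A \<inter> nbh A i t \<times> nbh A i t) i t lab lab' c c'" and
    g: "domain_verifier K W r (view_of t A lab c i) = good K W r (A \<inter> nbh A i t \<times> nbh A i t) lab' c' i"
    by (rule domain_verifier_view)
  show ?thesis using view_restriction.good_restrict[OF v] assms g by simp
qed

lemma nbh_subset:
  assumes "A \<subseteq> N \<times> N" "i \<in> N"
  shows "nbh A i t \<subseteq> N"
proof -
  have "j \<in> N" if "(i, j) \<in> A ^^ m" for j m
    using that assms by (cases m) auto
  then show ?thesis by (auto simp: nbh_def)
qed

text \<open>At a single node the two conditions may differ, because truncation is harmless only if
  the surrounding domains are small. Either condition, required at all nodes, implies that all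
  domains are small.\<close>

lemma domain_verifier_all_iff:
  assumes "2 * K + 2 \<le> t" "r \<le> 1" "A \<subseteq> N \<times> N"
  shows "(\<forall>i \<in> N. domain_verifier K W r (view_of t A lab c i)) \<longleftrightarrow> (\<forall>i \<in> N. good K W r A lab c i)"
proof -
  have "domain_verifier K W r (view_of t A lab c i) \<longleftrightarrow> good K W r A lab c i"
    if "i \<in> N" and "\<And>l. l \<in> N \<Longrightarrow> dom_of A c l \<subseteq> nbh A l K" for i
    using domain_verifier_iff_good[OF assms(1,2)] nbh_subset[OF assms(3) that(1)] that(2) by blast
  moreover have "dom_of A c l \<subseteq> nbh A l K"
    if "domain_verifier K W r (view_of t A lab c l) \<or> good K W r A lab c l" for l
    using that domain_verifier_bounded[of K W r t A lab c l] assms(1) by (auto simp: good_def)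
  ultimately show ?thesis by blast
qed

section \<open>Soundness and completeness\<close>

lemma good_imp_accepted:
  assumes "sym A" "A \<subseteq> N \<times> N" "r \<le> 1" "\<And>i. i \<in> N \<Longrightarrow> good K W r A lab c i"
  shows "\<exists>g. \<forall>i \<in> N. W (view_of r A lab g i)"
proof -
  \<comment> \<open>The choice depends only on the domain as a set, so all nodes of a domain choose
    the same \<open>f\<close>.\<close>
  define F where "F S = (SOME f. \<forall>j \<in> S. fits W r A lab c f j)" for S
  define g where "g j = F (dom_of A c j) j" for j
  have F: "fits W r A lab c (F (dom_of A c i)) i" if "i \<in> N" for i
  proof -
    have "\<exists>f. \<forall>j \<in> dom_of A c i. fits W r A lab c f j" using assms(4)[OF that] by (simp add: good_def)
    then have "\<forall>j \<in> dom_of A c i. fits W r A lab c (F (dom_of A c i)) j" unfolding F_def by (rule someI_ex)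
    then show ?thesis by simp
  qed
  have "W (view_of r A lab g i)" if i: "i \<in> N" for i
  proof -
    have "g j = F (dom_of A c i) j" if "(i, j) \<in> A" for j
    proof (cases "level (c j) = level (c i)")
      case True
      then have "j \<in> dom_of A c i" using that by (auto simp: dom_of_def level_rel_def)
      then show ?thesis using dom_of_eq[OF assms(1)] by (simp add: g_def)
    next
      case False
      have ji: "(j, i) \<in> A" "j \<in> N" using that assms(1,2) by (auto dest: symD)
      have "level (c i) < 3" "level (c j) < 3" by (rule level_less)+
      \<comment> \<open>Both ends agree on which of them is the upper one. Hence both conditions
        concern the same stored pair, and the choices made in the two domains coincide on the
        arc.\<close>
      then have flip: "level (c j) = Suc (level (c i)) mod 3 \<longleftrightarrow> level (c i) \<noteq> Suc (level (c j)) mod 3"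
        using False mod_3_cases by metis
      let ?f = "F (dom_of A c i)" and ?f' = "F (dom_of A c j)"
      have "if level (c j) = Suc (level (c i)) mod 3 then payload A c j = (?f i, ?f j)
          else payload A c i = (?f j, ?f i)"
        using F[OF i] that False unfolding fits_def by blast
      moreover have "if level (c i) = Suc (level (c j)) mod 3 then payload A c i = (?f' j, ?f' i)
          else payload A c j = (?f' i, ?f' j)"
        using F[OF ji(2)] ji(1) False unfolding fits_def by metis
      ultimately show ?thesis using flip unfolding g_def by (metis prod.inject)
    qed
    \<comment> \<open>With radius at most 1 a view contains only the node and its neighbours, so
      agreement along arcs is enough.\<close>
    then have "g j = F (dom_of A c i) j" if "j \<in> nbh A i r" for j
      using nbh_le_1[OF that assms(3)] by (auto simp: g_def)
    then have "view_of r A lab g i = view_of r A lab (F (dom_of A c i)) i"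
      by (simp add: view_of_def)
    then show ?thesis using F[OF i] by (simp add: fits_def)
  qed
  then show ?thesis by blast
qed

text \<open>The certificates come from the intended domains, and the given \<open>q\<close> itself
  serves as the guess \<open>f\<close> in each of them.\<close>

lemma accepted_imp_good:
  fixes V :: "nat set"
  assumes tree: "rooted_tree V A r0 par d" and k: "k \<ge> 1"
    and acc: "\<And>i. i \<in> V \<Longrightarrow> W (view_of r A lab q i)"
    and len: "\<And>i. i \<in> V \<Longrightarrow> length (q i) \<le> s"
  shows "\<exists>c. \<forall>i \<in> V. good (4 * k) W r A lab c i \<and> length (c i) \<le> 3 + (3 * s + 1) div k"
proof -
  interpret rooted_tree V A r0 par d by fact
  \<comment> \<open>The chunk length: \<open>k\<close> chunks of \<open>m\<close> bits hold a joined
    pair.\<close>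
  define m where "m = (3 * s + 1) div k + 1"
  have mk: "3 * s + 1 \<le> m * k"
    using dividend_less_div_times[of k "3 * s + 1"] k by (simp add: m_def)
  define S where "S b = {u \<in> V. anchor k u = b}" for b
  \<comment> \<open>Only a domain with a cut above it stores a pair; in the topmost domain all
    chunks may be empty.\<close>
  have "\<exists>h. (\<forall>x. length (h x) \<le> m) \<and> (b \<in> V \<and> b \<noteq> r0 \<and> border k b \<longrightarrow>
      concat (map h (sorted_list_of_set (S b))) = join (q (par b)) (q b))" for b
  proof (cases "b \<in> V \<and> b \<noteq> r0 \<and> border k b")
    case True
    have "length (join (q (par b)) (q b)) \<le> 3 * s + 1"
      using len[of b] len[of "par b"] par_in True by (simp add: length_join)
    also have "\<dots> \<le> m * k" by (rule mk)
    also have "\<dots> \<le> m * card (S b)" using card_domain[of b k] True k by (simp add: S_def)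
    finally show ?thesis
      using split_into_chunks[of "sorted_list_of_set (S b)" "join (q (par b)) (q b)" m] by auto
  next
    case False
    then show ?thesis by (intro exI[of _ "\<lambda>_. []"]) auto
  qed
  then obtain h where h: "\<And>b x. length (h b x) \<le> m"
    "\<And>b. b \<in> V \<Longrightarrow> b \<noteq> r0 \<Longrightarrow> border k b \<Longrightarrow>
      concat (map (h b) (sorted_list_of_set (S b))) = join (q (par b)) (q b)"
    by metis
  define c where "c i = level_code (rank k i) @ h (anchor k i) i" for i
  have lev [simp]: "level (c i) = rank k i mod 3" for i by (simp add: c_def)
  have rel: "level_rel A c = level_arcs k" by (simp add: level_rel_def level_arcs_def)
  have dom: "dom_of A c i = S (anchor k i)" if "i \<in> V" for i
  proof -
    have "dom_of A c i = {v. (i, v) \<in> (level_arcs k)\<^sup>*}" by (auto simp: dom_of_def rel)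
    then show ?thesis unfolding S_def level_arcs_rtrancl[OF that k] by (simp add: eq_commute)
  qed
  have pay: "payload A c b = (q (par b), q b)" if "b \<in> V" "b \<noteq> r0" "border k b" for b
  proof -
    have "finite (S b)" using finite_V by (simp add: S_def)
    then have "map (\<lambda>j. drop 2 (c j)) (sorted_list_of_set (S b)) = map (h b) (sorted_list_of_set (S b))"
      by (auto simp: c_def level_code_def S_def)
    then have "concat (map (\<lambda>j. drop 2 (c j)) (sorted_list_of_set (S b))) = join (q (par b)) (q b)"
      using h(2)[OF that] by (simp only:)
    then show ?thesis unfolding payload_def dom[OF that(1)] anchor_border[OF that(3)] by simp
  qed
  have up: "payload A c b = (q p, q b)" if "(p, b) \<in> A" "rank k b mod 3 = Suc (rank k p) mod 3" for p b
    using up_arc[OF that] pay by metis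
  have fit: "fits W r A lab c q j" if "j \<in> V" for j
  proof -
    have "if level (c l) = Suc (level (c j)) mod 3 then payload A c l = (q j, q l)
        else payload A c j = (q l, q j)"
      if l: "(j, l) \<in> A" "level (c l) \<noteq> level (c j)" for l
    proof (cases "level (c l) = Suc (level (c j)) mod 3")
      case True
      then have "payload A c l = (q j, q l)" by (intro up[OF l(1)]) (simp only: lev mod_Suc_eq)
      then show ?thesis unfolding if_P[OF True] .
    next
      case False
      then have "level (c j) = Suc (level (c l)) mod 3"
        using mod_3_cases[OF level_less level_less l(2)] by simp
      then have "payload A c j = (q l, q j)"
        by (intro up[OF arcs_sym[OF l(1)]]) (simp only: lev mod_Suc_eq)
      then show ?thesis unfolding if_not_P[OF False] .
    qed
    then show ?thesis unfolding fits_def using acc[OF that] by blast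
  qed
  have "good (4 * k) W r A lab c i \<and> length (c i) \<le> 3 + (3 * s + 1) div k" if i: "i \<in> V" for i
  proof
    have "dom_of A c i \<subseteq> nbh A i (4 * k)"
    proof
      fix l assume "l \<in> dom_of A c i"
      then have "l \<in> V" "anchor k i = anchor k l" unfolding dom[OF i] S_def by simp_all
      then obtain n where "n \<le> 4 * k" "(i, l) \<in> level_arcs k ^^ n"
        using level_arcs_connect[OF i _ _ k] by blast
      moreover have "level_arcs k \<subseteq> A" by (auto simp: level_arcs_def)
      ultimately show "l \<in> nbh A i (4 * k)" using relpow_mono unfolding nbh_def by blast
    qed
    then show "good (4 * k) W r A lab c i" unfolding good_def using fit dom[OF i] S_def by blast
    show "length (c i) \<le> 3 + (3 * s + 1) div k" using h(1)[of "anchor k i" i] by (simp add: c_def level_code_def m_def)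
  qed
  then show ?thesis by blast
qed

section \<open>The size of the scheme\<close>

lemma view_all_transfer:
  assumes "is_tree G" "inj_on ident (pverts G)"
    and "\<And>u. u \<in> pverts G \<Longrightarrow> lab (ident u) = x u"
    and "\<And>u. u \<in> pverts G \<Longrightarrow> f (ident u) = cert u"
  shows "(\<forall>v \<in> pverts G. W (local_view_at r G x ident cert v)) \<longleftrightarrow>
    (\<forall>i \<in> ident ` pverts G. W (view_of r (map_prod ident ident ` parcs G) lab f i))"
proof -
  interpret pair_graph G using assms(1) by (simp add: is_tree_def)
  show ?thesis
    using local_view_at_eq[where lab = lab and f = f, OF pair_wf_digraph assms(2) _ assms(3,4)] by simp
qed

lemma domain_verifier_sound:
  assumes tree: "is_tree G" and inj: "inj_on ident (pverts G)" and r: "r \<le> 1" and t: "2 * K + 2 \<le> t"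
    and acc: "\<forall>v \<in> pverts G. domain_verifier K W r (local_view_at t G x ident cert v)"
  shows "\<exists>q. \<forall>v \<in> pverts G. W (local_view_at r G x ident q v)"
proof -
  interpret pair_graph G using tree by (simp add: is_tree_def)
  let ?N = "ident ` pverts G" and ?A = "map_prod ident ident ` parcs G"
    and ?inv = "the_inv_into (pverts G) ident"
  have inv: "?inv (ident u) = u" if "u \<in> pverts G" for u
    using inj that by (rule the_inv_into_f_f)
  have AN: "?A \<subseteq> ?N \<times> ?N" by (auto dest: in_arcsD1 in_arcsD2)
  have sym: "sym ?A" using arcs_symmetric by (force simp: sym_def)
  have "\<forall>i \<in> ?N. domain_verifier K W r (view_of t ?A (x \<circ> ?inv) (cert \<circ> ?inv) i)"
    using acc view_all_transfer[OF tree inj, where lab = "x \<circ> ?inv" and f = "cert \<circ> ?inv"] inv by simp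
  then have "\<forall>i \<in> ?N. good K W r ?A (x \<circ> ?inv) (cert \<circ> ?inv) i"
    using domain_verifier_all_iff[OF t r AN] by simp
  then obtain g where g: "\<forall>i \<in> ?N. W (view_of r ?A (x \<circ> ?inv) g i)"
    using good_imp_accepted[OF sym AN r] by blast
  have "\<forall>v \<in> pverts G. W (local_view_at r G x ident (g \<circ> ident) v)"
    using g view_all_transfer[OF tree inj, where lab = "x \<circ> ?inv" and f = g] inv by simp
  then show ?thesis by blast
qed

lemma domain_verifier_complete:
  assumes tree: "is_tree G" and inj: "inj_on ident (pverts G)" and r: "r \<le> 1"
    and k: "k \<ge> 1" and t: "8 * k + 2 \<le> t"
    and acc: "\<forall>v \<in> pverts G. W (local_view_at r G x ident q v)"
    and len: "\<forall>v \<in> pverts G. length (q v) \<le> s"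
  shows "\<exists>cert. \<forall>v \<in> pverts G. domain_verifier (4 * k) W r (local_view_at t G x ident cert v) \<and>
    length (cert v) \<le> 3 + (3 * s + 1) div k"
proof -
  interpret pair_graph G using tree by (simp add: is_tree_def)
  let ?N = "ident ` pverts G" and ?A = "map_prod ident ident ` parcs G"
    and ?inv = "the_inv_into (pverts G) ident"
  have inv: "?inv (ident u) = u" if "u \<in> pverts G" for u
    using inj that by (rule the_inv_into_f_f)
  have AN: "?A \<subseteq> ?N \<times> ?N" by (auto dest: in_arcsD1 in_arcsD2)
  have t': "2 * (4 * k) + 2 \<le> t" using t by simp
  obtain r0 par d where "rooted_tree (pverts G) (parcs G) r0 par d" using tree by (rule tree_rooted)
  then have rooted: "rooted_tree ?N ?A (ident r0) (ident \<circ> par \<circ> ?inv) (d \<circ> ?inv)"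
    using inj by (rule rooted_tree_image)
  have W: "W (view_of r ?A (x \<circ> ?inv) (q \<circ> ?inv) i)" if "i \<in> ?N" for i
    using acc view_all_transfer[OF tree inj, where lab = "x \<circ> ?inv" and f = "q \<circ> ?inv"] inv that by auto
  have L: "length ((q \<circ> ?inv) i) \<le> s" if "i \<in> ?N" for i
    using len inv that by auto
  obtain c where c: "\<forall>i \<in> ?N. good (4 * k) W r ?A (x \<circ> ?inv) c i \<and> length (c i) \<le> 3 + (3 * s + 1) div k"
    using accepted_imp_good[where W = W and r = r and lab = "x \<circ> ?inv" and q = "q \<circ> ?inv" and s = s,
        OF rooted k] W L by blast
  then have "\<forall>i \<in> ?N. domain_verifier (4 * k) W r (view_of t ?A (x \<circ> ?inv) c i)"
    using domain_verifier_all_iff[OF t' r AN] by simp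
  then have "\<forall>v \<in> pverts G. domain_verifier (4 * k) W r (local_view_at t G x ident (c \<circ> ident) v)"
    using view_all_transfer[OF tree inj, where lab = "x \<circ> ?inv" and f = c] inv by simp
  then show ?thesis using c by (intro exI[of _ "c \<circ> ident"]) simp
qed

section \<open>Minimal sizes\<close>

lemma size_pls_antimono: "t \<le> t' \<Longrightarrow> size_pls \<C> c P t' n \<le> size_pls \<C> c P t n"
  unfolding size_pls_def by (rule Inf_superset_mono) (blast intro: order_trans)

lemma size_pls_attained:
  assumes "size_pls \<C> c P t n \<noteq> \<infinity>"
  obtains r prover verifier where "r \<le> t" "is_pls \<C> c P r prover verifier"
    "scheme_size \<C> c P prover n = size_pls \<C> c P t n"
proof -
  define S where "S = {scheme_size \<C> c P prover n | r prover verifier. r \<le> t \<and> is_pls \<C> c P r prover verifier}"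
  have S: "size_pls \<C> c P t n = Inf S" by (simp add: size_pls_def S_def)
  then have "S \<noteq> {}" using assms by (auto simp: Inf_enat_def)
  then have "Inf S \<in> S" unfolding Inf_enat_def by (auto intro: LeastI)
  then show ?thesis using that unfolding S by (auto simp: S_def)
qed

text \<open>A scheme that is optimal for the given \<open>n\<close> is transformed. The result must
  be correct for trees of every size, but its certificates have to be short only on trees with
  \<open>n\<close> nodes.\<close>

lemma size_pls_domain:
  fixes P :: "'v predicate"
  assumes s: "size_pls labeled_trees c P 1 n = enat s" and k: "k \<ge> 1" and t: "8 * k + 2 \<le> t"
  shows "size_pls labeled_trees c P t n \<le> enat (3 + (3 * s + 1) div k)"
proof -
  obtain r prover W where r: "r \<le> 1" and pls: "is_pls labeled_trees c P r prover W"
    and size: "scheme_size labeled_trees c P prover n = enat s"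
    using size_pls_attained[of labeled_trees c P 1 n] s by auto
  define inst where "inst G x ident \<longleftrightarrow> is_tree G \<and> id_assignment c G ident"
    for G :: "'v pair_pre_digraph" and x :: "'v \<Rightarrow> bits" and ident
  have len: "length (prover G x ident v) \<le> s"
    if "inst G x ident" "card (pverts G) = n" "P G x ident" "v \<in> pverts G" for G x ident v
  proof -
    have "enat (length (prover G x ident v)) \<le> scheme_size labeled_trees c P prover n"
      unfolding scheme_size_def using that
      by (intro Sup_upper) (auto simp: inst_def labeled_trees_def)
    then show ?thesis using size by simp
  qed
  define ok where "ok G x ident cert \<longleftrightarrow>
    (\<forall>v \<in> pverts G. domain_verifier (4 * k) W r (local_view_at t G x ident cert v)) \<and>
    (card (pverts G) = n \<longrightarrow> (\<forall>v \<in> pverts G. length (cert v) \<le> 3 + (3 * s + 1) div k))"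
    for G :: "'v pair_pre_digraph" and x ident cert
  have ex: "\<exists>cert. ok G x ident cert" if i: "inst G x ident" "P G x ident" for G x ident
  proof -
    have tree: "is_tree G" and inj: "inj_on ident (pverts G)"
      using i by (auto simp: inst_def id_assignment_def)
    interpret pair_graph G using tree by (simp add: is_tree_def)
    have acc: "\<forall>v \<in> pverts G. W (local_view_at r G x ident (prover G x ident) v)"
      using pls i by (auto simp: is_pls_def inst_def labeled_trees_def)
    \<comment> \<open>On trees of other sizes \<open>s\<close> need not bound the certificates, but
      some bound exists for each instance. The verifier depends on neither bound.\<close>
    define s' where "s' = (if card (pverts G) = n then s else Max ((\<lambda>v. length (prover G x ident v)) ` pverts G))"
    have "\<forall>v \<in> pverts G. length (prover G x ident v) \<le> s'"
      using len[OF i(1) _ i(2)] pair_finite_verts by (auto simp: s'_def)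
    then obtain cert where "\<forall>v \<in> pverts G. domain_verifier (4 * k) W r (local_view_at t G x ident cert v) \<and>
        length (cert v) \<le> 3 + (3 * s' + 1) div k"
      using domain_verifier_complete[OF tree inj r k t acc] by blast
    then have "ok G x ident cert" by (auto simp: ok_def s'_def)
    then show ?thesis by blast
  qed
  define prover' where "prover' G x ident = (SOME cert. ok G x ident cert)" for G x ident
  have ok: "ok G x ident (prover' G x ident)" if "inst G x ident" "P G x ident" for G x ident
    unfolding prover'_def using ex[OF that] by (rule someI_ex)
  have "is_pls labeled_trees c P t prover' (domain_verifier (4 * k) W r)"
    unfolding is_pls_def
  proof (intro allI impI conjI)
    fix G :: "'v pair_pre_digraph" and x ident
    assume i: "(G, x) \<in> labeled_trees \<and> id_assignment c G ident"
    then have inst: "inst G x ident" by (simp add: inst_def labeled_trees_def)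
    show "\<forall>v \<in> pverts G. domain_verifier (4 * k) W r (local_view_at t G x ident (prover' G x ident) v)"
      if "P G x ident"
      using ok[OF inst that] by (simp add: ok_def)
    show "\<exists>v \<in> pverts G. \<not> domain_verifier (4 * k) W r (local_view_at t G x ident cert v)"
      if "\<not> P G x ident" for cert
    proof (rule ccontr)
      assume "\<not> ?thesis"
      then have "\<forall>v \<in> pverts G. domain_verifier (4 * k) W r (local_view_at t G x ident cert v)" by blast
      then obtain q where "\<forall>v \<in> pverts G. W (local_view_at r G x ident q v)"
        using domain_verifier_sound[of G ident r "4 * k" t W x cert] inst r t
        by (auto simp: inst_def id_assignment_def)
      then show False using pls i that unfolding is_pls_def by blast
    qed
  qed
  then have "size_pls labeled_trees c P t n \<le> scheme_size labeled_trees c P prover' n"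
    unfolding size_pls_def by (intro Inf_lower) blast
  also have "\<dots> \<le> enat (3 + (3 * s + 1) div k)"
    unfolding scheme_size_def
  proof (rule Sup_least)
    fix y assume "y \<in> {enat (length (prover' G x ident v)) | G x ident v.
            (G, x) \<in> labeled_trees \<and> id_assignment c G ident \<and> card (pverts G) = n \<and>
            P G x ident \<and> v \<in> pverts G}"
    then obtain G x ident v where y: "y = enat (length (prover' G x ident v))"
      "inst G x ident" "card (pverts G) = n" "P G x ident" "v \<in> pverts G"
      by (auto simp: inst_def labeled_trees_def)
    then show "y \<le> enat (3 + (3 * s + 1) div k)" using ok[OF y(2,4)] by (auto simp: ok_def)
  qed
  finally show ?thesis .
qed

theorem theorem4:
  fixes P :: "'v predicate" and c :: real
  assumes "c \<ge> 1"
  shows "\<exists>C::nat. \<forall>t n. t \<ge> 1 \<longrightarrow>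
    size_pls labeled_trees c P t n \<le> enat C * ceil_div (size_pls labeled_trees c P 1 n) t"
\<comment> \<open>The constant is 3 + 4 * 31: an additive 3 is at most \<open>3 * q\<close>, and
  \<open>3 * s + 1\<close> is at most \<open>4 * q * t\<close> with \<open>t\<close> at most
  \<open>31 * k\<close>.\<close>
proof (intro exI[of _ 127] allI impI)
  fix t n :: nat
  assume t: "t \<ge> 1"
  have mono: "size_pls labeled_trees c P t n \<le> size_pls labeled_trees c P 1 n"
    using t by (rule size_pls_antimono)
  show "size_pls labeled_trees c P t n \<le> enat 127 * ceil_div (size_pls labeled_trees c P 1 n) t"
  proof (cases "size_pls labeled_trees c P 1 n")
    case infinity
    then show ?thesis by (simp add: ceil_div_def)
  next
    case (enat s)
    define q where "q = nat \<lceil>real s / real t\<rceil>"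
    have "real s / real t \<le> real q" unfolding q_def by linarith
    then have "real s \<le> real (q * t)" using t by (simp add: field_simps)
    then have sq: "s \<le> q * t" by (simp only: of_nat_le_iff)
    have "size_pls labeled_trees c P t n \<le> enat (127 * q)"
    \<comment> \<open>For \<open>t < 16\<close> a scheme of radius at most 1 is already good enough,
      since \<open>s\<close> is at most \<open>16 * q\<close>; for \<open>s = 0\<close> there is
      nothing to save.\<close>
    proof (cases "s = 0 \<or> t < 16")
      case True
      have "s \<le> 127 * q"
      proof (cases "s = 0")
        case False
        then have "q * t \<le> q * 16" using True by (intro mult_le_mono2) simp
        then show ?thesis using sq by linarith
      qed simp
      then show ?thesis using mono enat order_trans by fastforce
    next
      case False
      \<comment> \<open>From \<open>t\<close> at least 16 follows \<open>k\<close> at least 1, hence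
        \<open>8 * k + 2\<close> is at most \<open>16 * k\<close> and so at most \<open>t\<close>;
        the remainder is at most 15, which gives the bound \<open>31 * k\<close> on
        \<open>t\<close>.\<close>
      define k where "k = t div 16"
      have "t = 16 * k + t mod 16" "t mod 16 < 16" by (simp_all add: k_def)
      moreover from this have "k \<ge> 1" using False by linarith
      ultimately have k: "k \<ge> 1" "8 * k + 2 \<le> t" "t \<le> 31 * k" by linarith+
      have q: "q \<ge> 1" using sq False by (cases q) auto
      have "3 * s + 1 \<le> 4 * (q * t)" using sq False by linarith
      also have "\<dots> \<le> 4 * (q * (31 * k))" using k(3) by simp
      finally have "3 * s + 1 \<le> (124 * q) * k" by simp
      then have "(3 * s + 1) div k \<le> ((124 * q) * k) div k" by (rule div_le_mono)
      then have "3 + (3 * s + 1) div k \<le> 127 * q" using k q by simp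
      then show ?thesis using size_pls_domain[OF enat k(1,2)] order_trans by fastforce
    qed
    then show ?thesis using enat by (simp add: ceil_div_def q_def)
  qed
qed

end
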